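(* Let $\delta \in (0,1)$ and let $\mathcal{C}:\{\pm 1\}^k \to \{\pm 1\}^n$ be a $(3,\delta)$-strong LDC. Then $n \ge \Omega_\delta(k^2/\log k)$; that is, there is a constant $c_\delta>0$ depending only on $\delta$ such that every $(3,\delta)$-strong LDC $\mathcal{C}:\{\pm 1\}^k \to \{\pm 1\}^n$ with $k\ge 2$ satisfies $n \ge c_\delta\, k^2/\log k$.
   Context: For $\delta\in(0,1)$, a map $\mathcal{C}:\{\pm1\}^k\to\{\pm1\}^n$ is a $(3,\delta)$-strong LDC if for every $i\in[k]$ there is a set $M_i$ of at least $\delta n$ pairwise disjoint $3$-element subsets (triples) of $[n]$ such that for every $x\in\{\pm1\}^k$ and every triple $\{j_1,j_2,j_3\}\in M_i$ we have $x_i=\mathcal{C}(x)_{j_1}\cdot\mathcal{C}(x)_{j_2}\cdot\mathcal{C}(x)_{j_3}$; moreover, for $i\neq i'$, any triple in $M_i$ and any triple in $M_{i'}$ share at most one element. *)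

theory Defs
  imports Complex_Main "HOL-Library.FuncSet" "HOL-Library.Disjoint_Sets"
begin

definition pm_cube :: "nat \<Rightarrow> (nat \<Rightarrow> real) set" where
  "pm_cube m = {1..m} \<rightarrow>\<^sub>E {-1, 1}"

definition strong_LDC3 ::
  "real \<Rightarrow> nat \<Rightarrow> nat \<Rightarrow> ((nat \<Rightarrow> real) \<Rightarrow> (nat \<Rightarrow> real)) \<Rightarrow> bool" where
  "strong_LDC3 \<delta> k n C \<longleftrightarrow>
     C \<in> pm_cube k \<rightarrow> pm_cube n \<and>
     (\<exists>M :: nat \<Rightarrow> nat set set.
        (\<forall>i\<in>{1..k}.
           (\<forall>T\<in>M i. T \<subseteq> {1..n} \<and> card T = 3) \<and>
           disjoint (M i) \<and>
           real (card (M i)) \<ge> \<delta> * real n \<and>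
           (\<forall>x\<in>pm_cube k. \<forall>T\<in>M i. x i = (\<Prod>j\<in>T. C x j))) \<and>
        (\<forall>i\<in>{1..k}. \<forall>i'\<in>{1..k}. i \<noteq> i' \<longrightarrow>
           (\<forall>T\<in>M i. \<forall>T'\<in>M i'. card (T \<inter> T') \<le> 1)))"

end

theory Submission imports Defs begin

text \<open>
  Let \<open>v\<^sub>j\<close> be the set of those \<open>i\<close> for which flipping the \<open>i\<close>-th bit of the all-ones message
  gives a codeword with \<open>j\<close>-th entry \<open>-1\<close>. Decoding says that, in the vector space of sets under
  symmetric difference, the three vectors of any triple of \<open>M\<^sub>i\<close> add up to the unit vector \<open>{i}\<close>,
  so the code may be treated as linear.

  Take a set \<open>S\<close> of about \<open>\<delta>k/2\<close> positions that lie in the most triples. Gaussian elimination gives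
  a linear map that kills \<open>v\<^sub>s\<close> for \<open>s \<in> S\<close> and fixes all but \<open>card S\<close> unit vectors. Every triple
  of a surviving \<open>M\<^sub>i\<close> that meets \<open>S\<close> then leaves a pair of positions whose images differ exactly
  in direction \<open>i\<close>. There are at least of order \<open>\<delta>\<^sup>2k\<^sup>2\<close> such pairs, while edge isoperimetry in the
  hypercube allows at most \<open>n ln n\<close> of them.
\<close>

section \<open>Edge isoperimetry in the hypercube\<close>

text \<open>Numerical core of the isoperimetric induction: two parts of sizes \<open>a\<close> and
  \<open>b\<close> are joined by at most \<open>min a b\<close> edges. Applying ln z \<le> z - 1 at
  a/(a+b) and at b/(a+b) gives a slack of 2ab/(a+b), the harmonic mean, which is at least the
  minimum.\<close>

lemma ln_superadditive_min:
  fixes a b :: nat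
  shows "real a * ln (real a) + real b * ln (real b) + real (min a b)
    \<le> real (a + b) * ln (real (a + b))"
proof (cases "a = 0 \<or> b = 0")
  case False
  then have pos: "real a > 0" "real b > 0" by auto
  have *: "x * ln x + x * (y / (x + y)) \<le> x * ln (x + y)" if "x > 0" "y > 0" for x y :: real
  proof -
    have "1 + - y / (x + y) = x / (x + y)" using that by (simp add: field_simps)
    then have "ln (x / (x + y)) \<le> - y / (x + y)"
      using ln_le_minus_one[of "x / (x + y)"] that by simp
    then have "ln x + y / (x + y) \<le> ln (x + y)"
      using that by (simp add: ln_div)
    then show ?thesis
      using mult_left_mono[of "ln x + y / (x + y)" "ln (x + y)" x] that
      by (simp add: distrib_left)
  qed
  have "real (min a b) * (real a + real b) \<le> 2 * (real a * real b)"
  proof (cases "a \<le> b")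
    case True
    then show ?thesis using mult_left_mono[of "real a" "real b" "real a"]
      by (simp add: algebra_simps)
  next
    case False
    then show ?thesis using mult_left_mono[of "real b" "real a" "real b"]
      by (simp add: algebra_simps)
  qed
  then have "real (min a b) \<le> 2 * (real a * real b) / (real a + real b)"
    using pos by (simp add: pos_le_divide_eq)
  also have "\<dots> = real a * (real b / (real a + real b)) + real b * (real a / (real b + real a))"
    by (simp add: add.commute mult.commute)
  finally have "real (min a b) \<le>
      real a * (real b / (real a + real b)) + real b * (real a / (real b + real a))" .
  with *[OF pos] *[OF pos(2) pos(1)] show ?thesis
    unfolding of_nat_add distrib_right add.commute[of "real b" "real a"] by linarith
qed auto

lemma card_disjoint_meeting_le:
  assumes "disjoint F" and "finite A" and "\<And>e. e \<in> F \<Longrightarrow> e \<inter> A \<noteq> {}"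
  shows "card F \<le> card A"
proof -
  have "\<forall>e\<in>F. \<exists>a. a \<in> e \<inter> A" using assms(3) by blast
  then obtain g where g: "\<And>e. e \<in> F \<Longrightarrow> g e \<in> e \<inter> A" by metis
  have "inj_on g F"
  proof (rule inj_onI)
    fix d e assume "d \<in> F" "e \<in> F" "g d = g e"
    then have "d \<inter> e \<noteq> {}" using g by fastforce
    then show "d = e" using assms(1) \<open>d \<in> F\<close> \<open>e \<in> F\<close> by (auto dest: disjointD)
  qed
  moreover have "g ` F \<subseteq> A" using g by blast
  ultimately show ?thesis using assms(2) by (metis card_inj_on_le)
qed

lemma disjoint_subset: "disjoint F \<Longrightarrow> G \<subseteq> F \<Longrightarrow> disjoint G"
  by (auto simp: disjoint_def pairwise_def)

text \<open>Induction on the set of directions, cutting \<open>V\<close> by whether the label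
  \<open>c v\<close> contains the new direction \<open>p\<close>. Edges in another direction have
  ends that agree on \<open>p\<close>, so they stay inside one part. The map \<open>c\<close> may
  give several points the same label; it is the disjointness of each \<open>E i\<close> that bounds
  the edges crossing the cut.\<close>

lemma hypercube_edge_isoperimetry:
  fixes c :: "'v \<Rightarrow> 'i set" and E :: "'i \<Rightarrow> 'v set set"
  assumes "finite I" and "finite V"
    and "\<And>i. i \<in> I \<Longrightarrow> disjoint (E i)"
    and "\<And>i e. i \<in> I \<Longrightarrow> e \<in> E i \<Longrightarrow>
      e \<subseteq> V \<and> (\<exists>a b. e = {a, b} \<and> sym_diff (c a) (c b) = {i})"
  shows "real (\<Sum>i\<in>I. card (E i)) \<le> real (card V) * ln (real (card V))"
  using assms
proof (induction I arbitrary: V E rule: finite_induct)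
  case empty
  have "0 \<le> real (card V) * ln (real (card V))"
    by (cases "card V") simp_all
  then show ?case by simp
next
  case (insert p I)
  define V0 where "V0 = {v \<in> V. p \<notin> c v}"
  define V1 where "V1 = {v \<in> V. p \<in> c v}"
  have fin: "finite V0" "finite V1" and V: "V = V0 \<union> V1" "V0 \<inter> V1 = {}"
    using insert.prems(1) by (auto simp: V0_def V1_def)
  have cardV: "card V = card V0 + card V1"
    using V fin by (simp add: card_Un_disjoint)
  have meets: "e \<inter> V0 \<noteq> {}" "e \<inter> V1 \<noteq> {}" if e: "e \<in> E p" for e
  proof -
    obtain a b where ab: "e = {a, b}" "sym_diff (c a) (c b) = {p}" "e \<subseteq> V"
      using insert.prems(3)[OF _ e] by auto
    then have "p \<in> sym_diff (c a) (c b)" by blast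
    with ab show "e \<inter> V0 \<noteq> {}" "e \<inter> V1 \<noteq> {}"
      by (auto simp: V0_def V1_def)
  qed
  \<comment> \<open>The edges in direction \<open>p\<close> are disjoint and each has an end in both
    parts, so they inject into either part.\<close>
  have Ep: "card (E p) \<le> min (card V0) (card V1)"
    using card_disjoint_meeting_le[of "E p"] meets insert.prems(2)[of p] fin by simp
  have finE: "finite (E i)" if "i \<in> I" for i
    by (rule finite_subset[of _ "Pow V"]) (use insert.prems that in auto)
  define E0 where "E0 i = {e \<in> E i. e \<subseteq> V0}" for i
  define E1 where "E1 i = {e \<in> E i. e \<subseteq> V1}" for i
  have split: "card (E i) \<le> card (E0 i) + card (E1 i)" if i: "i \<in> I" for i
  proof -
    have "E i \<subseteq> E0 i \<union> E1 i"
    proof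
      fix e assume e: "e \<in> E i"
      obtain a b where ab: "e = {a, b}" "sym_diff (c a) (c b) = {i}" "e \<subseteq> V"
        using insert.prems(3)[OF _ e] i by auto
      have "p \<notin> sym_diff (c a) (c b)" using ab i insert.hyps by auto
      then show "e \<in> E0 i \<union> E1 i"
        using ab e by (auto simp: E0_def E1_def V0_def V1_def)
    qed
    then have "card (E i) \<le> card (E0 i \<union> E1 i)"
      using finE[OF i] by (intro card_mono) (auto simp: E0_def E1_def)
    then show ?thesis using card_Un_le[of "E0 i" "E1 i"] by linarith
  qed
  have IH0: "real (\<Sum>i\<in>I. card (E0 i)) \<le> real (card V0) * ln (real (card V0))"
  proof (rule insert.IH[OF fin(1)])
    show "disjoint (E0 i)" if "i \<in> I" for i
      using disjoint_subset[of "E i" "E0 i"] insert.prems(2)[of i] that by (auto simp: E0_def)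
  qed (use insert.prems(3) in \<open>auto simp: E0_def\<close>)
  have IH1: "real (\<Sum>i\<in>I. card (E1 i)) \<le> real (card V1) * ln (real (card V1))"
  proof (rule insert.IH[OF fin(2)])
    show "disjoint (E1 i)" if "i \<in> I" for i
      using disjoint_subset[of "E i" "E1 i"] insert.prems(2)[of i] that by (auto simp: E1_def)
  qed (use insert.prems(3) in \<open>auto simp: E1_def\<close>)
  have "(\<Sum>i\<in>insert p I. card (E i)) = card (E p) + (\<Sum>i\<in>I. card (E i))"
    using insert.hyps by simp
  also have "\<dots> \<le> min (card V0) (card V1) + ((\<Sum>i\<in>I. card (E0 i)) + (\<Sum>i\<in>I. card (E1 i)))"
    unfolding sum.distrib[symmetric] by (intro add_mono Ep sum_mono split)
  finally have "real (\<Sum>i\<in>insert p I. card (E i)) \<le>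
      real (min (card V0) (card V1)) + (real (\<Sum>i\<in>I. card (E0 i)) + real (\<Sum>i\<in>I. card (E1 i)))"
    unfolding of_nat_add[symmetric] by (rule of_nat_mono)
  with IH0 IH1 ln_superadditive_min[of "card V0" "card V1"]
  show ?case unfolding cardV by linarith
qed

section \<open>Elimination in the space of sets under symmetric difference, and averaging\<close>

text \<open>The vectors \<open>v s\<close> are eliminated one at a time, and \<open>R\<close>
  collects the pivots. A vector whose image is already empty costs no pivot, hence
  \<open>card R\<close> is at most \<open>card S\<close>.\<close>

lemma gaussian_elimination_sets:
  fixes v :: "'j \<Rightarrow> 'i set"
  assumes "finite S"
  obtains \<phi> R where "\<forall>A B. \<phi> (sym_diff A B) = sym_diff (\<phi> A) (\<phi> B)" "\<forall>s\<in>S. \<phi> (v s) = {}"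
    "finite R" "card R \<le> card S" "\<forall>i. i \<notin> R \<longrightarrow> \<phi> {i} = {i :: 'i}"
  using assms
proof (induction S arbitrary: thesis)
  case empty
  show ?case by (rule empty.prems[of id "{}"]) auto
next
  case (insert s S)
  obtain \<phi> R where add: "\<forall>A B. \<phi> (sym_diff A B) = sym_diff (\<phi> A) (\<phi> B)"
    and kill: "\<forall>s\<in>S. \<phi> (v s) = {}" and R: "finite R" "card R \<le> card S"
    and fx: "\<forall>i. i \<notin> R \<longrightarrow> \<phi> {i} = {i}" by (rule insert.IH)
  show ?case
  proof (cases "\<phi> (v s) = {}")
    case True
    show ?thesis
    proof (rule insert.prems[OF add _ R(1)])
      show "\<forall>r\<in>insert s S. \<phi> (v r) = {}" using True kill by simp
      show "card R \<le> card (insert s S)" using R insert.hyps by simp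
    qed (rule fx)
  next
    case False
    then obtain p where p: "p \<in> \<phi> (v s)" by blast
    \<comment> \<open>Adding \<open>\<phi> (v s)\<close> to every image that contains the pivot
      \<open>p\<close> sends \<open>v s\<close> to the empty set. Images without \<open>p\<close>
      stay as they are: the empty images of earlier vectors, and \<open>{i}\<close> for i outside
      \<open>insert p R\<close>. Additivity survives because containing \<open>p\<close> is itself
      additive modulo 2.\<close>
    define \<psi> where "\<psi> A = (if p \<in> \<phi> A then sym_diff (\<phi> A) (\<phi> (v s)) else \<phi> A)" for A
    show ?thesis
    proof (rule insert.prems[of \<psi> "insert p R"])
      have "\<psi> (sym_diff A B) = sym_diff (\<psi> A) (\<psi> B)" for A B
        unfolding \<psi>_def add[rule_format] using p by (cases "p \<in> \<phi> A"; cases "p \<in> \<phi> B") auto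
      then show "\<forall>A B. \<psi> (sym_diff A B) = sym_diff (\<psi> A) (\<psi> B)" by blast
      show "\<forall>r\<in>insert s S. \<psi> (v r) = {}"
        using kill p by (simp add: \<psi>_def)
      show "finite (insert p R)" using R by simp
      show "card (insert p R) \<le> card (insert s S)"
        using R insert.hyps by (simp add: card_insert_if)
      show "\<forall>i. i \<notin> insert p R \<longrightarrow> \<psi> {i} = {i}"
        using fx by (simp add: \<psi>_def)
    qed
  qed
qed

text \<open>Deleting a minimiser of \<open>f\<close> never lowers the average, so elements are
  deleted until \<open>t\<close> remain. The averages are compared in cross-multiplied form.\<close>

lemma exists_subset_sum_ge_average:
  fixes f :: "'a \<Rightarrow> real"
  assumes "finite A" and "t \<le> card A"
  shows "\<exists>S\<subseteq>A. card S = t \<and> real t * sum f A \<le> real (card A) * sum f S"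
  using assms
proof (induction "card A - t" arbitrary: A)
  case 0
  then show ?case by (intro exI[of _ A]) auto
next
  case (Suc d)
  then have ne: "A \<noteq> {}" and "t < card A" by auto
  define m where "m = arg_min_on f A"
  have m: "m \<in> A" "\<And>a. a \<in> A \<Longrightarrow> f m \<le> f a"
    using arg_min_if_finite(1)[OF \<open>finite A\<close> ne, of f] arg_min_least[OF \<open>finite A\<close> ne, of _ f]
    by (auto simp: m_def)
  have cardm: "card (A - {m}) = card A - 1" using m(1) by simp
  have "d = card (A - {m}) - t" "finite (A - {m})" "t \<le> card (A - {m})"
    using Suc.hyps(2) Suc.prems cardm \<open>t < card A\<close> by auto
  then obtain S where S: "S \<subseteq> A - {m}" "card S = t"
      "real t * sum f (A - {m}) \<le> real (card (A - {m})) * sum f S"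
    using Suc.hyps(1)[of "A - {m}"] by blast
  \<comment> \<open>Minimality of \<open>m\<close> pays for its own removal: \<open>t\<close> copies
    of \<open>f m\<close> fit into the one extra copy of \<open>sum f S\<close> that separates
    \<open>card A - 1\<close> from \<open>card A\<close>.\<close>
  have "real t * f m \<le> sum f S"
    using sum_mono[of S "\<lambda>_. f m" f] m(2) S by auto
  moreover have "sum f A = f m + sum f (A - {m})"
    using m(1) Suc.prems by (simp add: sum.remove)
  moreover have "real (card (A - {m})) = real (card A) - 1"
    using cardm \<open>t < card A\<close> by simp
  ultimately have "real t * sum f A \<le> real (card A) * sum f S"
    using S(3) by (simp add: left_diff_distrib distrib_left)
  then show ?case using S by blast
qed

lemma sym_diff_triple_elim:
  assumes "\<forall>A B. \<phi> (sym_diff A B) = sym_diff (\<phi> A) (\<phi> B)"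
    and "sym_diff (sym_diff a b) s = {i}" and "\<phi> s = {}" and "\<phi> {i} = {i}"
  shows "sym_diff (\<phi> a) (\<phi> b) = {i}"
  using assms(1)[rule_format, of "sym_diff a b" s] assms(1)[rule_format, of a b] assms(2-4)
  by simp

lemma card_3_obtain:
  assumes "card T = 3" and "s \<in> T"
  obtains a b where "{a, b, s} = T" "T - {s} = {a, b}" "a \<noteq> b" "a \<noteq> s" "b \<noteq> s"
proof -
  have "card (T - {s}) = 2" using assms by simp
  then obtain a b where "T - {s} = {a, b}" "a \<noteq> b" by (auto simp: card_2_iff)
  with assms(2) show thesis by (intro that[of a b]) auto
qed

section \<open>The bound for linear codes\<close>

lemma linear_LDC3_bound:
  fixes v :: "nat \<Rightarrow> nat set" and M :: "nat \<Rightarrow> nat set set"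
  assumes "0 < \<delta>" and "n \<ge> 1"
    and triple: "\<And>i T. i \<in> {1..k} \<Longrightarrow> T \<in> M i \<Longrightarrow> T \<subseteq> {1..n} \<and> card T = 3"
    and disj: "\<And>i. i \<in> {1..k} \<Longrightarrow> disjoint (M i)"
    and large: "\<And>i. i \<in> {1..k} \<Longrightarrow> \<delta> * real n \<le> real (card (M i))"
    and decode: "\<And>i a b s. i \<in> {1..k} \<Longrightarrow> {a, b, s} \<in> M i \<Longrightarrow> a \<noteq> b \<Longrightarrow> a \<noteq> s \<Longrightarrow> b \<noteq> s \<Longrightarrow>
      sym_diff (sym_diff (v a) (v b)) (v s) = {i}"
  shows "k \<le> n"
    and "t \<le> k \<Longrightarrow> real t * (\<delta> * real k - real t) \<le> real n * ln (real n)"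
proof -
  have finM: "finite (M i)" if "i \<in> {1..k}" for i
    by (rule finite_subset[of _ "Pow {1..n}"]) (use triple that in auto)
  show kn: "k \<le> n"
  proof -
    obtain \<phi> R where add: "\<forall>A B. \<phi> (sym_diff A B) = sym_diff (\<phi> A) (\<phi> B)"
      and kill: "\<forall>s\<in>{1..n}. \<phi> (v s) = {}" and R: "finite R" "card R \<le> card {1..n}"
      and fx: "\<forall>i. i \<notin> R \<longrightarrow> \<phi> {i} = {i}"
      by (rule gaussian_elimination_sets[OF finite_atLeastAtMost])
    \<comment> \<open>With all positions killed, a triple decoding an index i outside
      \<open>R\<close> would make \<open>{i}\<close> empty. So every index is a pivot, and there are
      at most n pivots.\<close>
    have "{1..k} \<subseteq> R"
    proof
      fix i assume i: "i \<in> {1..k}"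
      have "0 < \<delta> * real n" using assms(1,2) by simp
      then have "card (M i) > 0" using large[OF i] by linarith
      then obtain T where T: "T \<in> M i" by (auto simp: card_gt_0_iff)
      then obtain s where s: "s \<in> T" using triple[OF i T] by fastforce
      then obtain a b where ab: "{a, b, s} = T" "a \<noteq> b" "a \<noteq> s" "b \<noteq> s"
        using card_3_obtain triple[OF i T] by metis
      then have ins: "a \<in> {1..n}" "b \<in> {1..n}" "s \<in> {1..n}" using triple[OF i T] by auto
      show "i \<in> R"
        using sym_diff_triple_elim[OF add decode[OF i, of a b s]] kill fx ins ab T by auto
    qed
    then show ?thesis using card_mono[OF R(1), of "{1..k}"] R(2) by simp
  qed
  assume "t \<le> k"
  define f where "f s = (\<Sum>i\<in>{1..k}. real (card {T \<in> M i. s \<in> T}))" for s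
  \<comment> \<open>Here \<open>k \<le> n\<close> is what leaves room for \<open>t\<close> positions
    in \<open>{1..n}\<close>.\<close>
  obtain S where S: "S \<subseteq> {1..n}" "card S = t" "real t * sum f {1..n} \<le> real n * sum f S"
    using exists_subset_sum_ge_average[of "{1..n}" t f] \<open>t \<le> k\<close> kn by auto
  have finS: "finite S" using S(1) finite_subset by blast
  define H where "H i = {T \<in> M i. T \<inter> S \<noteq> {}}" for i
  have double_count: "(\<Sum>s\<in>A. card {T \<in> M i. s \<in> T}) = (\<Sum>T\<in>M i. card (T \<inter> A))"
    if "finite A" "i \<in> {1..k}" for A i
  proof -
    have "(\<Sum>s\<in>A. card {T \<in> M i. s \<in> T}) = (\<Sum>s\<in>A. \<Sum>T\<in>M i. if s \<in> T then 1 else 0)"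
      using finM[OF that(2)] by (simp add: sum.If_cases Int_def)
    also have "\<dots> = (\<Sum>T\<in>M i. \<Sum>s\<in>A. if s \<in> T then 1 else 0)" by (rule sum.swap)
    also have "\<dots> = (\<Sum>T\<in>M i. card (T \<inter> A))"
      using that(1) by (simp add: sum.If_cases Int_def conj_commute)
    finally show ?thesis .
  qed
  have "sum f {1..n} = (\<Sum>i\<in>{1..k}. real (\<Sum>s\<in>{1..n}. card {T \<in> M i. s \<in> T}))"
    unfolding f_def of_nat_sum by (rule sum.swap)
  also have "\<dots> = (\<Sum>i\<in>{1..k}. real (\<Sum>T\<in>M i. card (T \<inter> {1..n})))"
    by (rule sum.cong) (auto simp: double_count)
  also have "\<dots> = (\<Sum>i\<in>{1..k}. 3 * real (card (M i)))"
  proof (rule sum.cong[OF refl])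
    fix i assume i: "i \<in> {1..k}"
    have "(\<Sum>T\<in>M i. card (T \<inter> {1..n})) = (\<Sum>T\<in>M i. 3)"
      using triple[OF i] by (intro sum.cong) (auto simp: Int_absorb2)
    then show "real (\<Sum>T\<in>M i. card (T \<inter> {1..n})) = 3 * real (card (M i))" by simp
  qed
  also have "\<dots> \<ge> (\<Sum>i\<in>{1..k}. 3 * (\<delta> * real n))"
    using large by (intro sum_mono) auto
  finally have f_all: "3 * \<delta> * real n * real k \<le> sum f {1..n}" by (simp add: algebra_simps)
  have "sum f S = (\<Sum>i\<in>{1..k}. real (\<Sum>s\<in>S. card {T \<in> M i. s \<in> T}))"
    unfolding f_def of_nat_sum by (rule sum.swap)
  also have "\<dots> = (\<Sum>i\<in>{1..k}. real (\<Sum>T\<in>M i. card (T \<inter> S)))"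
    by (rule sum.cong) (auto simp: double_count[OF finS])
  also have "\<dots> \<le> (\<Sum>i\<in>{1..k}. 3 * real (card (H i)))"
  proof (rule sum_mono)
    fix i assume i: "i \<in> {1..k}"
    have "(\<Sum>T\<in>M i. card (T \<inter> S)) = (\<Sum>T\<in>H i. card (T \<inter> S))"
      using finM[OF i] by (intro sum.mono_neutral_right) (auto simp: H_def)
    also have "\<dots> \<le> (\<Sum>T\<in>H i. 3)"
    proof (rule sum_mono)
      fix T assume "T \<in> H i"
      then have "T \<in> M i" by (simp add: H_def)
      then show "card (T \<inter> S) \<le> 3"
        using triple[OF i] card_mono[of T "T \<inter> S"] by (metis Int_lower1 card.infinite zero_neq_numeral)
    qed
    finally have "(\<Sum>T\<in>M i. card (T \<inter> S)) \<le> 3 * card (H i)" by simp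
    then show "real (\<Sum>T\<in>M i. card (T \<inter> S)) \<le> 3 * real (card (H i))"
      by (metis of_nat_le_iff of_nat_mult of_nat_numeral)
  qed
  finally have f_S: "sum f S \<le> 3 * real (\<Sum>i\<in>{1..k}. card (H i))"
    by (simp add: sum_distrib_left)
  \<comment> \<open>A triple contributes exactly 3 to the sum of \<open>f\<close> over all positions
    and at most 3 to its sum over \<open>S\<close>, so the factor 3 cancels.\<close>
  have "real n * (\<delta> * real k * real t) \<le> real n * real (\<Sum>i\<in>{1..k}. card (H i))"
    using mult_left_mono[OF f_all, of "real t"] S(3) mult_left_mono[OF f_S, of "real n"]
    by (simp add: algebra_simps)
  then have hits: "\<delta> * real k * real t \<le> real (\<Sum>i\<in>{1..k}. card (H i))"
    using \<open>n \<ge> 1\<close> by (subst (asm) mult_le_cancel_left_pos) auto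
  obtain \<phi> R where add: "\<forall>A B. \<phi> (sym_diff A B) = sym_diff (\<phi> A) (\<phi> B)"
    and kill: "\<forall>s\<in>S. \<phi> (v s) = {}" and R: "finite R" "card R \<le> card S"
    and fx: "\<forall>i. i \<notin> R \<longrightarrow> \<phi> {i} = {i}"
    by (rule gaussian_elimination_sets[OF finS])
  \<comment> \<open>A triple may meet \<open>S\<close> in several positions. Only one is removed, so
    that a pair always remains; its ends may still lie in \<open>S\<close>.\<close>
  define g where "g T = (SOME s. s \<in> T \<inter> S)" for T
  have g: "g T \<in> T \<inter> S" if "T \<inter> S \<noteq> {}" for T
    unfolding g_def by (rule someI_ex) (use that in blast)
  define E where "E i = (\<lambda>T. T - {g T}) ` H i" for i
  have disjH: "disjoint (H i)" if "i \<in> {1..k}" for i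
    using disjoint_subset[OF disj[OF that]] by (auto simp: H_def)
  have pair: "\<exists>a b. {a, b, g T} = T \<and> T - {g T} = {a, b} \<and> a \<noteq> b \<and> a \<noteq> g T \<and> b \<noteq> g T"
    if "i \<in> {1..k}" "T \<in> H i" for i T
  proof -
    have "card T = 3" "g T \<in> T" using that triple[of i T] g[of T] by (auto simp: H_def)
    then obtain a b where "{a, b, g T} = T" "T - {g T} = {a, b}" "a \<noteq> b" "a \<noteq> g T" "b \<noteq> g T"
      by (rule card_3_obtain)
    then show ?thesis by (intro exI conjI)
  qed
  have cardE: "card (E i) = card (H i)" if i: "i \<in> {1..k}" for i
    unfolding E_def
  proof (rule card_image, rule inj_onI)
    fix T U assume TU: "T \<in> H i" "U \<in> H i" "T - {g T} = U - {g U}"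
    \<comment> \<open>No two triples leave the same pair: a common nonempty remainder would
      contradict disjointness.\<close>
    have "T - {g T} \<noteq> {}" using pair[OF i TU(1)] by force
    then have "T \<inter> U \<noteq> {}" using TU(3) by blast
    then show "T = U" using disjH[OF i] TU by (auto dest: disjointD)
  qed
  have "real (\<Sum>i\<in>{1..k} - R. card (E i)) \<le> real (card {1..n}) * ln (real (card {1..n}))"
  proof (rule hypercube_edge_isoperimetry[where c = "\<lambda>j. \<phi> (v j)"])
    show "disjoint (E i)" if "i \<in> {1..k} - R" for i
    proof (rule disjointI)
      fix d e assume "d \<in> E i" "e \<in> E i" "d \<noteq> e"
      then obtain T U where "T \<in> H i" "U \<in> H i" "T \<noteq> U" "d = T - {g T}" "e = U - {g U}"
        by (auto simp: E_def)
      then show "d \<inter> e = {}" using disjointD[OF disjH[of i], of T U] that by blast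
    qed
    fix i e assume i: "i \<in> {1..k} - R" and "e \<in> E i"
    then obtain T where T: "T \<in> H i" "e = T - {g T}" by (auto simp: E_def)
    then obtain a b where ab: "{a, b, g T} = T" "T - {g T} = {a, b}" "a \<noteq> b" "a \<noteq> g T" "b \<noteq> g T"
      using pair[of i T] i by blast
    have TM: "T \<in> M i" "g T \<in> S" using T g[of T] by (auto simp: H_def)
    \<comment> \<open>Since \<open>\<phi>\<close> kills the vector at \<open>g T\<close> and fixes
      \<open>{i}\<close> for i outside \<open>R\<close>, the decoding identity becomes an edge in
      direction i.\<close>
    have "sym_diff (sym_diff (v a) (v b)) (v (g T)) = {i}"
      using decode[of i a b "g T"] i TM(1) ab(3-5) unfolding ab(1) by blast
    then have "sym_diff (\<phi> (v a)) (\<phi> (v b)) = {i}"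
      by (rule sym_diff_triple_elim[OF add]) (use kill TM fx i in auto)
    moreover have "e = {a, b}" using T(2) ab(2) by simp
    moreover have "e \<subseteq> {1..n}" using triple[of i T] TM i T(2) by auto
    ultimately show "e \<subseteq> {1..n} \<and> (\<exists>a b. e = {a, b} \<and> sym_diff (\<phi> (v a)) (\<phi> (v b)) = {i})"
      by blast
  qed auto
  moreover have "(\<Sum>i\<in>{1..k} - R. card (E i)) = (\<Sum>i\<in>{1..k} - R. card (H i))"
    by (rule sum.cong) (auto simp: cardE)
  ultimately have iso: "real (\<Sum>i\<in>{1..k} - R. card (H i)) \<le> real n * ln (real n)"
    by (simp del: of_nat_sum)
  \<comment> \<open>The price of elimination: at most \<open>t\<close> indices are pivots, and for
    each of them at most \<open>t\<close> disjoint triples meet \<open>S\<close>.\<close>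
  have "(\<Sum>i\<in>{1..k} \<inter> R. card (H i)) \<le> (\<Sum>i\<in>{1..k} \<inter> R. t)"
    using card_disjoint_meeting_le[OF disjH finS] S(2)
    by (intro sum_mono) (auto simp: H_def)
  also have "\<dots> \<le> t * t"
    using card_mono[OF R(1), of "{1..k} \<inter> R"] R(2) S(2) by (simp add: mult_le_mono1)
  finally have lost: "(\<Sum>i\<in>{1..k} \<inter> R. card (H i)) \<le> t * t" .
  have "(\<Sum>i\<in>{1..k}. card (H i)) = (\<Sum>i\<in>{1..k} \<inter> R. card (H i)) + (\<Sum>i\<in>{1..k} - R. card (H i))"
    by (rule sum.Int_Diff) simp
  then have "(\<Sum>i\<in>{1..k}. card (H i)) \<le> t * t + (\<Sum>i\<in>{1..k} - R. card (H i))"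
    using lost by linarith
  then have "real (\<Sum>i\<in>{1..k}. card (H i)) \<le> real (t * t + (\<Sum>i\<in>{1..k} - R. card (H i)))"
    by (rule of_nat_mono)
  with hits iso show "real t * (\<delta> * real k - real t) \<le> real n * ln (real n)"
    by (simp add: algebra_simps)
qed

section \<open>Reduction of an arbitrary code to the linear case\<close>

lemma strong_LDC3_bound:
  assumes "0 < \<delta>" and "n \<ge> 1" and "strong_LDC3 \<delta> k n C"
    and "t \<le> k"
  shows "real t * (\<delta> * real k - real t) \<le> real n * ln (real n)"
proof -
  from assms(3) obtain M where C: "C \<in> pm_cube k \<rightarrow> pm_cube n"
    and M: "\<forall>i\<in>{1..k}. (\<forall>T\<in>M i. T \<subseteq> {1..n} \<and> card T = 3) \<and> disjoint (M i) \<and>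
      \<delta> * real n \<le> real (card (M i)) \<and> (\<forall>x\<in>pm_cube k. \<forall>T\<in>M i. x i = (\<Prod>j\<in>T. C x j))"
    unfolding strong_LDC3_def by (elim conjE exE)
  have triple: "T \<subseteq> {1..n} \<and> card T = 3" if "i \<in> {1..k}" "T \<in> M i" for i T
    using bspec[OF M that(1)] that(2) by blast
  have disj: "disjoint (M i)" and large: "\<delta> * real n \<le> real (card (M i))"
    if "i \<in> {1..k}" for i using bspec[OF M that] by blast+
  have dec: "x i = (\<Prod>j\<in>T. C x j)" if "i \<in> {1..k}" "x \<in> pm_cube k" "T \<in> M i" for i x T
    using bspec[OF M that(1)] that(2,3) by blast
  \<comment> \<open>Only these \<open>k\<close> messages, each with the single bit \<open>l\<close>
    flipped, are ever decoded. The restricted lambda makes them extensional, as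
    \<open>pm_cube\<close> requires.\<close>
  define x where "x l = (\<lambda>i\<in>{1..k}. if i = l then -1 else 1 :: real)" for l
  have x: "x l \<in> pm_cube k" for l by (auto simp: x_def pm_cube_def)
  have Cx: "C (x l) j = -1 \<or> C (x l) j = 1" if "j \<in> {1..n}" for l j
    using PiE_mem[OF funcset_mem[OF C x, unfolded pm_cube_def] that] by auto
  define v where "v j = {l \<in> {1..k}. C (x l) j = -1}" for j
  have "sym_diff (sym_diff (v a) (v b)) (v s) = {i}"
    if i: "i \<in> {1..k}" and T: "{a, b, s} \<in> M i" and ne: "a \<noteq> b" "a \<noteq> s" "b \<noteq> s" for i a b s
  proof -
    \<comment> \<open>A product of three signs is -1 exactly when an odd number of them are, and
      this parity is membership in the threefold symmetric difference.\<close>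
    have "l \<in> sym_diff (sym_diff (v a) (v b)) (v s) \<longleftrightarrow> l = i" if l: "l \<in> {1..k}" for l
    proof -
      have "x l i = C (x l) a * C (x l) b * C (x l) s"
        using dec[OF i x T, of l] ne by (simp add: mult.assoc)
      moreover have "x l i = (if i = l then -1 else 1)" using i by (simp add: x_def)
      moreover have "a \<in> {1..n}" "b \<in> {1..n}" "s \<in> {1..n}" using triple[OF i T] by auto
      ultimately show ?thesis using Cx[of a l] Cx[of b l] Cx[of s l] l
        by (auto simp: v_def split: if_splits)
    qed
    moreover have "sym_diff (sym_diff (v a) (v b)) (v s) \<subseteq> {1..k}" by (auto simp: v_def)
    ultimately show ?thesis using i by blast
  qed
  with assms(1,2,4) triple disj large show ?thesis
    by (intro linear_LDC3_bound(2)[where M = M and v = v and k = k]) simp_all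
qed

section \<open>Choice of parameters\<close>

theorem theorem1p3:
  fixes \<delta> :: real
  assumes "0 < \<delta>" and "\<delta> < 1"
  shows "\<exists>c>0. \<forall>(k::nat) (n::nat) C. k \<ge> 2 \<longrightarrow> n \<ge> 1 \<longrightarrow> strong_LDC3 \<delta> k n C \<longrightarrow>
           real n \<ge> c * (real k)\<^sup>2 / ln (real k)"
\<comment> \<open>Taking \<open>t\<close> near \<delta>k/2 bounds n ln n below by \<delta>^2 k^2 /
  8; replacing ln n by 2 ln k costs another factor 2.\<close>
proof (rule exI[of _ "\<delta>\<^sup>2 / 16"], intro conjI allI impI)
  show "0 < \<delta>\<^sup>2 / 16" using assms by simp
  fix k n :: nat and C
  assume k: "k \<ge> 2" and n: "n \<ge> 1" and C: "strong_LDC3 \<delta> k n C"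
  have "(1::real) / 2 \<le> ln 2" using ln_le_minus_one[of "1 / 2 :: real"] by (simp add: ln_div)
  then have lnk: "1 / 2 \<le> ln (real k)" using k ln_mono[of 2 "real k"] by linarith
  have "\<delta>\<^sup>2 / 16 * (real k)\<^sup>2 \<le> real n * ln (real k)"
  \<comment> \<open>For small \<delta>k the floor defining \<open>t\<close> would be 0, but then the
    left side is at most 1/4 and the right side at least 1/2.\<close>
  proof (cases "\<delta> * real k < 2")
    case True
    have "(\<delta> * real k)\<^sup>2 \<le> 2\<^sup>2" using True assms by (intro power_mono) auto
    moreover have "1 * (1 / 2) \<le> real n * ln (real k)"
      using n lnk by (intro mult_mono) auto
    ultimately show ?thesis by (simp add: power_mult_distrib)
  next
    case False
    define t where "t = nat \<lfloor>\<delta> * real k / 2\<rfloor>"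
    have "1 \<le> \<lfloor>\<delta> * real k / 2\<rfloor>" using False by (simp add: le_floor_iff)
    \<comment> \<open>Rounding down a number that is at least 1 loses at most half of it.\<close>
    then have t: "real t \<le> \<delta> * real k / 2" "\<delta> * real k / 4 \<le> real t"
      unfolding t_def by linarith+
    have "\<delta> * real k \<le> 1 * real k" using assms by (intro mult_right_mono) auto
    then have "t \<le> k" using t(1) by linarith
    have "\<delta> * real k / 4 * (\<delta> * real k / 2) \<le> real t * (\<delta> * real k - real t)"
      using t False by (intro mult_mono) auto
    also have "\<dots> \<le> real n * ln (real n)"
      using strong_LDC3_bound[OF assms(1) n C \<open>t \<le> k\<close>] .
    finally have main: "\<delta>\<^sup>2 * (real k)\<^sup>2 / 8 \<le> real n * ln (real n)"
      by (simp add: power2_eq_square algebra_simps)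
    show ?thesis
    \<comment> \<open>Up to k^2, ln n is at most 2 ln k. Beyond k^2 the claim follows from the size
      of n alone, as ln k is at least 1/2.\<close>
    proof (cases "real n \<le> (real k)\<^sup>2")
      case True
      have "ln (real n) \<le> ln ((real k)\<^sup>2)" using True n by (intro ln_mono) auto
      also have "\<dots> = 2 * ln (real k)" using k by (simp add: ln_realpow)
      finally have "real n * ln (real n) \<le> real n * (2 * ln (real k))"
        by (rule mult_left_mono) simp
      with main show ?thesis by simp
    next
      case False
      have "\<delta>\<^sup>2 \<le> 1" using assms by (simp add: power_le_one)
      then have "\<delta>\<^sup>2 / 16 * (real k)\<^sup>2 \<le> (1 / 2) * (real k)\<^sup>2"
        by (intro mult_right_mono) auto
      also have "\<dots> \<le> ln (real k) * real n" using False lnk by (intro mult_mono) auto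
      finally show ?thesis by (simp add: mult.commute)
    qed
  qed
  then show "real n \<ge> \<delta>\<^sup>2 / 16 * (real k)\<^sup>2 / ln (real k)"
    using lnk by (simp add: pos_divide_le_eq)
qed

end
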